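(* For each $n\ge 1$ let $M_n$ be a matching of size $n$. Then: \begin{enumerate} \item $\mathrm{SP}_{\mathbb{R}}(M_n)=\lceil \sqrt{n}\,\rceil$ for all $n$. \item If $F_k=\infty$ for every positive integer $k$, then $\mathrm{SP}_{\mathbb{Z}}(M_n)=\lceil\sqrt{n}\,\rceil$ for all $n$. \item Conversely, if $F_k<\infty$ for some $k$, then $\mathrm{SP}_{\mathbb{Z}}(M_n)=\Omega\big(n^{k/(2k-1)}\big)$. Furthermore, for every fixed positive integer $k$, every $t=t(n)$ and every injective map $A$ from the vertices of $M_n$ to $\{-t,\ldots,t\}$, $$\max\{|A+_{M_n}A|,\ |A\times_{M_n}A|\}=\Omega\Big(n^{k/(2k-1)}\,[F_k(4t^2)]^{-1/(2k-1)}\Big).$$ \end{enumerate}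
   Context: A matching of size $n$ is a graph consisting of $n$ pairwise disjoint edges. For a finite simple graph $G=(V,E)$, a ring $R$ and an injective map $A=(a_u)_{u\in V}$ from $V$ to $R$, put $A+_G A=\{a_u+a_v : uv\in E\}$ and $A\times_G A=\{a_u a_v : uv\in E\}$. $\mathrm{SP}_R(G)$ is the minimum of $\max\{|A+_G A|,|A\times_G A|\}$ over all injections $A:V\to R$. Let $\mathrm{SQ}=\{z^2: z\in\mathbb{Z}\}$. For a positive integer $k$, $F_k=\max_{A\subset\mathbb{Z},|A|=k}\#\{x\in\mathbb{Z}: A+x\subset \mathrm{SQ}\}$, where $A+x=\{a+x:a\in A\}$, with $F_k=\infty$ if these numbers are unbounded (or infinite for some $A$). Also $F_k(N)=\max\#\{x\in\{-N,\ldots,N\}: A+x\subset\mathrm{SQ}\}$, the maximum being over $k$-element subsets $A\subset\{-N,\ldots,N\}$. The $\Omega$ notation is for $n\to\infty$ with $k$ fixed; the implied constant in the last bound depends only on $k$ (not on $t$ or $A$). *)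

theory Defs
  imports
    Complex_Main
    "HOL-Library.Extended_Nat"
    "HOL-Library.Disjoint_Sets"
    "HOL-Library.Landau_Symbols"
begin

type_synonym 'v graph = "'v set \<times> 'v set set"

abbreviation verts :: "'v graph \<Rightarrow> 'v set" where
  "verts \<equiv> fst"

abbreviation edges :: "'v graph \<Rightarrow> 'v set set" where
  "edges \<equiv> snd"

definition simple_graph :: "'v graph \<Rightarrow> bool" where
  "simple_graph G \<longleftrightarrow> finite (verts G) \<and> (\<forall>e\<in>edges G. e \<subseteq> verts G \<and> card e = 2)"

definition matching_of_size :: "nat \<Rightarrow> 'v graph \<Rightarrow> bool" where
  "matching_of_size n G \<longleftrightarrow>
     simple_graph G \<and> disjoint (edges G) \<and> card (edges G) = n \<and> verts G = \<Union> (edges G)"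

definition sumset_along :: "'v graph \<Rightarrow> ('v \<Rightarrow> 'r::ring) \<Rightarrow> 'r set" where
  "sumset_along G a = {a u + a v | u v. {u, v} \<in> edges G}"

definition prodset_along :: "'v graph \<Rightarrow> ('v \<Rightarrow> 'r::ring) \<Rightarrow> 'r set" where
  "prodset_along G a = {a u * a v | u v. {u, v} \<in> edges G}"

definition sp_max :: "'v graph \<Rightarrow> ('v \<Rightarrow> 'r::ring) \<Rightarrow> nat" where
  "sp_max G a = max (card (sumset_along G a)) (card (prodset_along G a))"

text \<open>The infimum of a nonempty set of natural numbers is attained, so this is a minimum
  whenever the ring admits an injection from the vertices (in particular for every infinite ring).\<close>

definition SP :: "'r::ring itself \<Rightarrow> 'v graph \<Rightarrow> nat" where
  "SP R G = (INF a \<in> {a :: 'v \<Rightarrow> 'r. inj_on a (verts G)}. sp_max G a)"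

definition SQ :: "int set" where
  "SQ = {z\<^sup>2 | z. True}"

definition ecard :: "'a set \<Rightarrow> enat" where
  "ecard X = (if finite X then enat (card X) else \<infinity>)"

definition F :: "nat \<Rightarrow> enat" where
  "F k = (SUP A \<in> {A :: int set. finite A \<and> card A = k}. ecard {x. (\<lambda>a. a + x) ` A \<subseteq> SQ})"

text \<open>The supremum below ranges over finitely many sets, hence is a maximum, except that
  it is \<open>0\<close> when the interval has fewer than \<open>k\<close> elements.\<close>

definition F_upto :: "nat \<Rightarrow> nat \<Rightarrow> nat" where
  "F_upto k N =
     (SUP A \<in> {A. A \<subseteq> {- int N..int N} \<and> card A = k}.
        card {x \<in> {- int N..int N}. (\<lambda>a. a + x) ` A \<subseteq> SQ})"

end

theory Submission
  imports Defs
begin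

text \<open>
  In an integral domain an unordered pair \<open>{u, v}\<close> is determined by the sum \<open>s = u + v\<close> and the
  product \<open>p = u v\<close>, being the root set of \<open>X\<^sup>2 - s X + p\<close>. So the edges of a matching inject into
  (sums) \<open>\<times>\<close> (products), which gives the lower bound \<open>\<lceil>\<surd>n\<rceil>\<close> over every integral domain
  (\<open>size_le_sp_max_square\<close>).

  The bound is attained once there are \<open>m = \<lceil>\<surd>n\<rceil>\<close> nonzero products and many sums for which all these
  quadratics split with distinct roots: a root \<open>z\<close> and a second product determine at most one
  other sum having \<open>z\<close> as a root, so a greedy choice leaves \<open>m\<close> sums for which the root pairs of all the
  quadratics are pairwise disjoint (\<open>matching_with_small_sp_max\<close>). Over the reals, negative products
  serve with arbitrary sums. Over the integers, if \<open>A + x\<close> consists of squares for many \<open>x\<close> and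
  \<open>b \<in> A\<close>, then with \<open>\<sigma>\<^sup>2 = b + x\<close> and \<open>\<tau>\<^sup>2 = a + x\<close> the integers \<open>\<sigma> + \<tau>\<close>, \<open>\<sigma> - \<tau>\<close> have sum
  \<open>2 \<sigma>\<close> and product \<open>b - a\<close>, which depend on \<open>x\<close> and on \<open>a\<close> separately
  (\<open>int_sums_and_products\<close>).

  Conversely, over the integers the discriminant \<open>s\<^sup>2 - 4 p\<close> of every edge is a square. If \<open>k\<close> products
  \<open>p\<^sub>1, \<dots>, p\<^sub>k\<close> are all joined to \<open>s\<close>, the translate of \<open>{- 4 p\<^sub>1, \<dots>, - 4 p\<^sub>k}\<close> by \<open>s\<^sup>2\<close>
  consists of squares, so at most \<open>2 f\<close> sums \<open>s\<close> occur, where \<open>f\<close> bounds the number of such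
  translates. The bipartite graph of sums and products thus contains no complete bipartite graph on
  \<open>2 f + 1\<close> sums and \<open>k\<close> products, and the
  Kovari--Sos--Turan argument bounds its \<open>n\<close> edges by \<open>n ^ k \<le> f * (4 * k * N) ^ (2 * k - 1)\<close>, where \<open>N\<close> is
  the larger number of sums or products (\<open>kovari_sos_turan\<close>, \<open>sp_max_int_lower_bound\<close>).
\<close>

section \<open>Edges as pairs of a sum and a product\<close>

lemma sum_prod_determine_pair:
  fixes u v x y :: "'a::idom"
  assumes "u + v = x + y" "u * v = x * y"
  shows "{u, v} = {x, y}"
proof -
  have "(x - u) * (x - v) = x * x - x * (u + v) + u * v"
    by (simp add: algebra_simps)
  also have "\<dots> = 0" using assms by (simp add: algebra_simps)
  finally have "x = u \<or> x = v" by auto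
  then show ?thesis using assms by (auto simp: algebra_simps)
qed

lemma sumset_along_eq_image:
  assumes "simple_graph G"
  shows "sumset_along G a = sum a ` edges G"
proof -
  have op: "sum a {u, v} = a u + a v" if "{u, v} \<in> edges G" for u v
    using that assms by (cases "u = v") (auto simp: simple_graph_def)
  show ?thesis
  proof (intro set_eqI iffI)
    fix x assume "x \<in> sumset_along G a"
    then obtain u v where "{u, v} \<in> edges G" "x = a u + a v"
      unfolding sumset_along_def by blast
    then show "x \<in> sum a ` edges G" using op[of u v] by (intro image_eqI[of _ _ "{u, v}"]) auto
  next
    fix x assume "x \<in> sum a ` edges G"
    then obtain e where e: "e \<in> edges G" "x = sum a e" by blast
    then have "card e = 2" using assms by (simp add: simple_graph_def)
    then obtain u v where "e = {u, v}" by (meson card_2_iff)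
    then show "x \<in> sumset_along G a" using e op[of u v] unfolding sumset_along_def by auto
  qed
qed

lemma prodset_along_eq_image:
  fixes a :: "'v \<Rightarrow> 'a::idom"
  assumes "simple_graph G"
  shows "prodset_along G a = prod a ` edges G"
proof -
  have op: "prod a {u, v} = a u * a v" if "{u, v} \<in> edges G" for u v
    using that assms by (cases "u = v") (auto simp: simple_graph_def)
  show ?thesis
  proof (intro set_eqI iffI)
    fix x assume "x \<in> prodset_along G a"
    then obtain u v where "{u, v} \<in> edges G" "x = a u * a v"
      unfolding prodset_along_def by blast
    then show "x \<in> prod a ` edges G" using op[of u v] by (intro image_eqI[of _ _ "{u, v}"]) auto
  next
    fix x assume "x \<in> prod a ` edges G"
    then obtain e where e: "e \<in> edges G" "x = prod a e" by blast
    then have "card e = 2" using assms by (simp add: simple_graph_def)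
    then obtain u v where "e = {u, v}" by (meson card_2_iff)
    then show "x \<in> prodset_along G a" using e op[of u v] unfolding prodset_along_def by auto
  qed
qed

lemma finite_edges: "simple_graph G \<Longrightarrow> finite (edges G)"
  unfolding simple_graph_def by (meson PowI finite_Pow_iff finite_subset subsetI)

lemma inj_on_sum_prod_edges:
  fixes a :: "'v \<Rightarrow> 'a::idom"
  assumes "simple_graph G" "disjoint (edges G)" "inj_on a (verts G)"
  shows "inj_on (\<lambda>e. (sum a e, prod a e)) (edges G)"
proof (rule inj_onI)
  fix e e' assume e: "e \<in> edges G" "e' \<in> edges G"
    and eq: "(sum a e, prod a e) = (sum a e', prod a e')"
  have sub: "e \<subseteq> verts G" "e' \<subseteq> verts G" and c: "card e = 2" "card e' = 2"
    using e assms(1) by (auto simp: simple_graph_def)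
  obtain u v where uv: "e = {u, v}" "u \<noteq> v" using c by (auto simp: card_2_iff)
  obtain x y where xy: "e' = {x, y}" "x \<noteq> y" using c by (auto simp: card_2_iff)
  have "{a u, a v} = {a x, a y}"
    using eq uv xy by (intro sum_prod_determine_pair) auto
  then have "a ` e = a ` e'" using uv xy by auto
  then show "e = e'" using assms(3) sub by (simp add: inj_on_image_eq_iff)
qed

lemma size_le_sp_max_square:
  fixes a :: "'v \<Rightarrow> 'a::idom"
  assumes "matching_of_size n G" "inj_on a (verts G)"
  shows "n \<le> (sp_max G a)\<^sup>2"
proof -
  have G: "simple_graph G" "disjoint (edges G)" "card (edges G) = n"
    using assms(1) by (auto simp: matching_of_size_def)
  have fin: "finite (edges G)" using G finite_edges by blast
  have "n = card ((\<lambda>e. (sum a e, prod a e)) ` edges G)"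
    using inj_on_sum_prod_edges[OF G(1,2) assms(2)] G(3) by (simp add: card_image)
  also have "\<dots> \<le> card (sumset_along G a \<times> prodset_along G a)"
    using fin by (intro card_mono)
      (auto simp: sumset_along_eq_image[OF G(1)] prodset_along_eq_image[OF G(1)])
  also have "\<dots> \<le> sp_max G a * sp_max G a"
    by (auto simp: card_cartesian_product sp_max_def intro: mult_mono)
  finally show ?thesis by (simp add: power2_eq_square)
qed

lemma SP_attained:
  assumes "simple_graph G" "infinite (UNIV :: 'a::idom set)"
  obtains a :: "'v \<Rightarrow> 'a::idom" where "inj_on a (verts G)" "SP TYPE('a::idom) G = sp_max G a"
proof -
  have "finite (verts G)" using assms(1) by (simp add: simple_graph_def)
  moreover obtain C :: "'a set" where "finite C" "card C = card (verts G)"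
    using infinite_arbitrarily_large[OF assms(2)] by blast
  ultimately obtain b :: "'v \<Rightarrow> 'a" where "inj_on b (verts G)"
    using card_le_inj[of "verts G" C] by auto
  then have "sp_max G ` {a :: 'v \<Rightarrow> 'a. inj_on a (verts G)} \<noteq> {}" by blast
  from Inf_nat_def1[OF this] show ?thesis using that by (auto simp: SP_def)
qed

section \<open>Realising all pairs from few sums and few products\<close>

text \<open>Greedy choice of an independent set in a graph of degree at most \<open>d\<close>.\<close>

lemma conflict_free_subset:
  fixes conf :: "'a \<Rightarrow> 'a \<Rightarrow> bool"
  assumes "finite X" "j * (d + 1) \<le> card X"
    and "\<And>s. s \<in> X \<Longrightarrow> card {s' \<in> X. conf s s'} \<le> d"
    and sym: "\<And>s s'. conf s s' \<Longrightarrow> conf s' s"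
  shows "\<exists>T \<subseteq> X. card T = j \<and> (\<forall>s\<in>T. \<forall>s'\<in>T. s \<noteq> s' \<longrightarrow> \<not> conf s s')"
  using assms(1-3)
proof (induction j arbitrary: X)
  case 0
  then show ?case by (intro exI[of _ "{}"]) auto
next
  case (Suc j)
  then obtain s where s: "s \<in> X" by fastforce
  define Y where "Y = insert s {s' \<in> X. conf s s'}"
  have "card Y \<le> d + 1"
    unfolding Y_def using Suc.prems s card_insert_le_m1 by (simp add: card_insert_if le_SucI)
  moreover have "Y \<subseteq> X" "finite Y" using s Suc.prems by (auto simp: Y_def)
  ultimately have le: "j * (d + 1) \<le> card (X - Y)"
    using Suc.prems by (simp add: card_Diff_subset)
  have "card {s' \<in> X - Y. conf r s'} \<le> d" if "r \<in> X - Y" for r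
  proof -
    have "card {s' \<in> X - Y. conf r s'} \<le> card {s' \<in> X. conf r s'}"
      using Suc.prems by (intro card_mono) auto
    then show ?thesis using Suc.prems(3)[of r] that by simp
  qed
  with Suc.IH[of "X - Y"] le Suc.prems(1) obtain T where
    T: "T \<subseteq> X - Y" "card T = j" "\<forall>s\<in>T. \<forall>s'\<in>T. s \<noteq> s' \<longrightarrow> \<not> conf s s'"
    by auto
  have "finite T" using T Suc.prems finite_subset by blast
  moreover have "s \<notin> T" "\<forall>r\<in>T. \<not> conf s r" using T(1) by (auto simp: Y_def)
  ultimately show ?case
    using T s sym by (intro exI[of _ "insert s T"]) (auto simp: Y_def)
qed

text \<open>An element \<open>z\<close> is a root of \<open>X\<^sup>2 - s X + p\<close> iff \<open>z (s - z) = p\<close>. Two sums conflict if some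
  \<open>z\<close> is a root for both, with products in \<open>P\<close>. A sum \<open>s\<close> has at most \<open>2 m\<close> such
  roots, and each of them, combined with one of the \<open>m\<close> products, determines at most one
  conflicting sum.\<close>

lemma sums_without_common_roots:
  fixes X P :: "'a::idom set"
  assumes P: "finite P" "0 \<notin> P" "card P = m"
    and X: "finite X" "m * (2 * m\<^sup>2 + 1) \<le> card X"
    and split: "\<And>s p. s \<in> X \<Longrightarrow> p \<in> P \<Longrightarrow> \<exists>u v. u + v = s \<and> u * v = p"
  shows "\<exists>T \<subseteq> X. card T = m \<and>
    (\<forall>s\<in>T. \<forall>s'\<in>T. \<forall>z. z * (s - z) \<in> P \<longrightarrow> z * (s' - z) \<in> P \<longrightarrow> s = s')"
proof -
  define conf where "conf s s' = (\<exists>z. z * (s - z) \<in> P \<and> z * (s' - z) \<in> P)" for s s' :: 'a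
  have "card {s' \<in> X. conf s s'} \<le> 2 * m\<^sup>2" if s: "s \<in> X" for s
  proof -
    define Z where "Z = {z. z * (s - z) \<in> P}"
    have "\<forall>p\<in>P. \<exists>u v. u + v = s \<and> u * v = p" using split s by blast
    then obtain u v where uv: "\<And>p. p \<in> P \<Longrightarrow> u p + v p = s \<and> u p * v p = p"
      by metis
    have Zsub: "Z \<subseteq> u ` P \<union> v ` P"
    proof
      fix z assume "z \<in> Z"
      then have p: "z * (s - z) \<in> P" by (simp add: Z_def)
      define q where "q = z * (s - z)"
      have "{z, s - z} = {u q, v q}"
        using uv p by (intro sum_prod_determine_pair) (auto simp: q_def)
      then show "z \<in> u ` P \<union> v ` P" using p by (auto simp: q_def[symmetric] doubleton_eq_iff)
    qed
    have cZ: "card Z \<le> 2 * m"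
    proof -
      have "card Z \<le> card (u ` P \<union> v ` P)" using Zsub P(1) by (intro card_mono) auto
      also have "\<dots> \<le> card (u ` P) + card (v ` P)" by (rule card_Un_le)
      also have "\<dots> \<le> m + m" using P by (intro add_mono) (auto intro: card_image_le)
      finally show ?thesis by simp
    qed
    have fZ: "finite Z" using Zsub P(1) finite_subset by blast
    have "\<forall>s'\<in>{s' \<in> X. conf s s'}. \<exists>z. z * (s - z) \<in> P \<and> z * (s' - z) \<in> P"
      by (auto simp: conf_def)
    then obtain w where
      w: "\<And>s'. s' \<in> {s' \<in> X. conf s s'} \<Longrightarrow> w s' * (s - w s') \<in> P \<and> w s' * (s' - w s') \<in> P"
      by metis
    have "card {s' \<in> X. conf s s'} \<le> card (Z \<times> P)"
    proof (rule card_inj_on_le[where f = "\<lambda>s'. (w s', w s' * (s' - w s'))"])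
      show "inj_on (\<lambda>s'. (w s', w s' * (s' - w s'))) {s' \<in> X. conf s s'}"
      proof (rule inj_onI)
        fix r r' assume r: "r \<in> {s' \<in> X. conf s s'}" "r' \<in> {s' \<in> X. conf s s'}"
          "(w r, w r * (r - w r)) = (w r', w r' * (r' - w r'))"
        \<comment> \<open>a common root is nonzero because \<open>0\<close> is not in \<open>P\<close>, so it can be cancelled\<close>
        have "w r \<noteq> 0" using w[OF r(1)] P(2) by auto
        then show "r = r'" using r(3) by auto
      qed
    qed (use w fZ P(1) in \<open>auto simp: Z_def\<close>)
    also have "\<dots> \<le> 2 * m * m" using cZ P(3) by (simp add: card_cartesian_product)
    finally show ?thesis by (simp add: power2_eq_square)
  qed
  moreover have "conf s s' \<Longrightarrow> conf s' s" for s s' by (auto simp: conf_def)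
  ultimately obtain T where "T \<subseteq> X" "card T = m"
      "\<forall>s\<in>T. \<forall>s'\<in>T. s \<noteq> s' \<longrightarrow> \<not> conf s s'"
    using conflict_free_subset[OF X, of conf] by auto
  then show ?thesis unfolding conf_def by blast
qed

text \<open>Each edge is assigned its own pair \<open>q = (s, p)\<close> of a chosen sum and a product, and its two
  endpoints are sent to the two roots belonging to \<open>q\<close>. Distinct edges get disjoint root pairs: for
  distinct sums by the choice of the sums, and for equal sums because a root and the sum determine
  the product.\<close>

lemma matching_with_small_sp_max:
  fixes X P :: "'a::idom set" and G :: "'v graph"
  assumes G: "matching_of_size n G" "n \<le> m\<^sup>2"
    and P: "finite P" "0 \<notin> P" "card P = m"
    and X: "finite X" "m * (2 * m\<^sup>2 + 1) \<le> card X"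
    and split: "\<And>s p. s \<in> X \<Longrightarrow> p \<in> P \<Longrightarrow> \<exists>u v. u \<noteq> v \<and> u + v = s \<and> u * v = p"
  shows "\<exists>a :: 'v \<Rightarrow> 'a. inj_on a (verts G) \<and> sp_max G a \<le> m"
proof -
  have split': "\<exists>u v. u + v = s \<and> u * v = p" if "s \<in> X" "p \<in> P" for s p
    using split[OF that] by blast
  obtain T where T: "T \<subseteq> X" "card T = m"
    and free: "\<And>s s' z. s \<in> T \<Longrightarrow> s' \<in> T \<Longrightarrow> z * (s - z) \<in> P \<Longrightarrow> z * (s' - z) \<in> P \<Longrightarrow> s = s'"
    using sums_without_common_roots[OF P X split'] by blast
  have fT: "finite T" using T X finite_subset by blast
  have "\<forall>q\<in>T \<times> P. \<exists>u v. u \<noteq> v \<and> u + v = fst q \<and> u * v = snd q"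
    using split T by auto
  then obtain u v where
    uv: "\<And>q. q \<in> T \<times> P \<Longrightarrow> u q \<noteq> v q \<and> u q + v q = fst q \<and> u q * v q = snd q"
    by metis
  have simple: "simple_graph G" and disj: "disjoint (edges G)" and cE: "card (edges G) = n"
    and V: "verts G = \<Union> (edges G)"
    using G by (auto simp: matching_of_size_def)
  have "card (edges G) \<le> card (T \<times> P)"
    using G(2) cE T P by (simp add: card_cartesian_product power2_eq_square)
  then obtain g where g: "g ` edges G \<subseteq> T \<times> P" "inj_on g (edges G)"
    using card_le_inj[OF finite_edges[OF simple]] fT P(1) by (metis finite_cartesian_product)
  have "\<exists>q. {fst q, snd q} = e \<and> fst q \<noteq> snd q" if "e \<in> edges G" for e
  proof -
    have "card e = 2" using simple that by (simp add: simple_graph_def)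
    then show ?thesis by (auto simp: card_2_iff)
  qed
  then have "\<forall>e\<in>edges G. \<exists>q. {fst q, snd q} = e \<and> fst q \<noteq> snd q" by blast
  from bchoice[OF this] obtain h where
    h: "\<forall>e\<in>edges G. {fst (h e), snd (h e)} = e \<and> fst (h e) \<noteq> snd (h e)" ..
  define x y where "x e = fst (h e)" and "y e = snd (h e)" for e
  have xy: "{x e, y e} = e \<and> x e \<noteq> y e" if "e \<in> edges G" for e
    using h that by (simp add: x_def y_def)
  \<comment> \<open>every vertex lies on exactly one edge of the matching\<close>
  define ed where "ed w = (THE e. e \<in> edges G \<and> w \<in> e)" for w
  have ed: "ed w = e" if "e \<in> edges G" "w \<in> e" for e w
    unfolding ed_def using that disj by (intro the_equality) (auto simp: disjoint_def)
  define a where "a w = (if w = x (ed w) then u (g (ed w)) else v (g (ed w)))" for w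
  have ax: "a (x e) = u (g e)" and ay: "a (y e) = v (g e)" if "e \<in> edges G" for e
  proof -
    have "x e \<in> e" "y e \<in> e" "x e \<noteq> y e" using xy[OF that] by blast+
    then show "a (x e) = u (g e)" "a (y e) = v (g e)"
      using ed[OF that, of "x e"] ed[OF that, of "y e"] by (auto simp: a_def)
  qed
  have gT: "g e \<in> T \<times> P" if "e \<in> edges G" for e using g that by blast
  have root: "a w * (fst (g e) - a w) = snd (g e)" if "e \<in> edges G" "w \<in> e" for e w
  proof -
    have "w = x e \<or> w = y e" using xy[OF that(1)] that(2) by auto
    then show ?thesis
      using uv[OF gT[OF that(1)]] ax[OF that(1)] ay[OF that(1)]
      by (metis add_diff_cancel_left' add_diff_cancel_right' mult.commute)
  qed
  have inj: "inj_on a (verts G)"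
  proof (rule inj_onI)
    fix w w' assume "w \<in> verts G" "w' \<in> verts G" and eq: "a w = a w'"
    then obtain e e' where e: "e \<in> edges G" "w \<in> e" "e' \<in> edges G" "w' \<in> e'"
      unfolding V by blast
    have "fst (g e) = fst (g e')"
      using root[OF e(1,2)] root[OF e(3,4)] gT[OF e(1)] gT[OF e(3)] eq
      by (intro free[of _ _ "a w"]) (auto simp: mem_Times_iff)
    moreover from this have "snd (g e) = snd (g e')"
      using root[OF e(1,2)] root[OF e(3,4)] eq by simp
    ultimately have "e = e'" using g(2) e by (metis inj_onD prod_eqI)
    moreover have "a (x e) \<noteq> a (y e)" using uv[OF gT[OF e(1)]] ax ay e(1) by simp
    ultimately show "w = w'" using xy[OF e(1)] e(2,4) eq
      by (metis empty_iff insert_iff)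
  qed
  have "sum a e \<in> T" "prod a e \<in> P" if "e \<in> edges G" for e
  proof -
    have e: "{x e, y e} = e" "x e \<noteq> y e" using xy[OF that] by auto
    have "sum a {x e, y e} = a (x e) + a (y e)" "prod a {x e, y e} = a (x e) * a (y e)"
      using e(2) by simp_all
    then have "sum a e = a (x e) + a (y e)" "prod a e = a (x e) * a (y e)"
      unfolding e(1) .
    then show "sum a e \<in> T" "prod a e \<in> P"
      using uv[OF gT[OF that]] gT[OF that] ax[OF that] ay[OF that] by (auto simp: mem_Times_iff)
  qed
  then have "card (sumset_along G a) \<le> m" "card (prodset_along G a) \<le> m"
    using T(2) P fT card_mono[of T "sum a ` edges G"] card_mono[of P "prod a ` edges G"]
    by (auto simp: sumset_along_eq_image[OF simple] prodset_along_eq_image[OF simple])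
  then show ?thesis using inj by (auto simp: sp_max_def)
qed

lemma SP_eq_ceiling_sqrt:
  fixes G :: "'v graph"
  assumes G: "matching_of_size n G" and inf: "infinite (UNIV :: 'a::idom set)"
    and small: "\<And>m. \<exists>X P :: 'a::idom set. finite P \<and> 0 \<notin> P \<and> card P = m \<and> finite X \<and>
      m * (2 * m\<^sup>2 + 1) \<le> card X \<and> (\<forall>s\<in>X. \<forall>p\<in>P. \<exists>u v. u \<noteq> v \<and> u + v = s \<and> u * v = p)"
  shows "int (SP TYPE('a::idom) G) = \<lceil>sqrt (real n)\<rceil>"
proof (rule antisym)
  define m where "m = nat \<lceil>sqrt (real n)\<rceil>"
  have im: "int m = \<lceil>sqrt (real n)\<rceil>"
    unfolding m_def by (metis ceiling_mono ceiling_zero nat_0_le of_nat_0_le_iff real_sqrt_ge_zero)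
  have "sqrt (real n) \<le> real m"
    using im by (metis le_of_int_ceiling of_int_of_nat_eq)
  then have "real n \<le> (real m)\<^sup>2" using sqrt_le_D by blast
  then have "n \<le> m\<^sup>2" by (metis of_nat_le_iff of_nat_power)
  with small[of m] G obtain a :: "'v \<Rightarrow> 'a" where a: "inj_on a (verts G)" "sp_max G a \<le> m"
    using matching_with_small_sp_max by metis
  have "SP TYPE('a) G \<le> sp_max G a"
    unfolding SP_def using a(1) by (intro cINF_lower) auto
  then show "int (SP TYPE('a) G) \<le> \<lceil>sqrt (real n)\<rceil>" using a(2) im by linarith
next
  have "simple_graph G" using G by (simp add: matching_of_size_def)
  then obtain a :: "'v \<Rightarrow> 'a" where a: "inj_on a (verts G)" "SP TYPE('a) G = sp_max G a"
    using SP_attained inf by metis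
  have "n \<le> (SP TYPE('a) G)\<^sup>2" using size_le_sp_max_square[OF G a(1)] a(2) by simp
  then have "sqrt (real n) \<le> real (SP TYPE('a) G)"
    by (intro real_le_lsqrt) (auto simp flip: of_nat_power)
  then show "\<lceil>sqrt (real n)\<rceil> \<le> int (SP TYPE('a) G)" by (simp add: ceiling_le_iff)
qed

lemma real_sums_and_products:
  "\<exists>X P :: real set. finite P \<and> 0 \<notin> P \<and> card P = m \<and> finite X \<and>
      m * (2 * m\<^sup>2 + 1) \<le> card X \<and> (\<forall>s\<in>X. \<forall>p\<in>P. \<exists>u v. u \<noteq> v \<and> u + v = s \<and> u * v = p)"
proof -
  let ?P = "(\<lambda>j. - real j) ` {1..m}" and ?X = "real ` {..<m * (2 * m\<^sup>2 + 1)}"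
  have split: "\<exists>u v. u \<noteq> v \<and> u + v = s \<and> u * v = p" if sp: "s \<in> ?X" "p \<in> ?P" for s p
  proof -
    have "p < 0" using sp by auto
    then have pos: "0 < s\<^sup>2 - 4 * p" by (smt (verit) zero_le_power2)
    define r where "r = sqrt (s\<^sup>2 - 4 * p)"
    have r: "r > 0" "r\<^sup>2 = s\<^sup>2 - 4 * p" using pos by (auto simp: r_def)
    have "(s + r) / 2 * ((s - r) / 2) = (s\<^sup>2 - r\<^sup>2) / 4"
      by (simp add: power2_eq_square field_simps)
    then have "(s + r) / 2 * ((s - r) / 2) = p" using r by simp
    moreover have "(s + r) / 2 + (s - r) / 2 = s" by (simp add: field_simps)
    moreover have "(s + r) / 2 \<noteq> (s - r) / 2" using r by simp
    ultimately show ?thesis by blast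
  qed
  have "card ?P = m" by (subst card_image) (auto simp: inj_on_def)
  moreover have "m * (2 * m\<^sup>2 + 1) \<le> card ?X" by (subst card_image) (auto simp: inj_on_def)
  moreover have "finite ?P" "0 \<notin> ?P" "finite ?X" by auto
  ultimately show ?thesis using split
    by - (rule exI[where x = ?X], rule exI[where x = ?P], intro conjI ballI)
qed

text \<open>Differences of elements of \<open>A\<close> serve as the products. Taking \<open>Suc m\<close> elements leaves \<open>m\<close>
  nonzero differences to a fixed element \<open>b\<close>.\<close>

lemma int_sums_and_products:
  assumes "F (Suc m) = \<infinity>"
  shows "\<exists>X P :: int set. finite P \<and> 0 \<notin> P \<and> card P = m \<and> finite X \<and>
      m * (2 * m\<^sup>2 + 1) \<le> card X \<and> (\<forall>s\<in>X. \<forall>p\<in>P. \<exists>u v. u \<noteq> v \<and> u + v = s \<and> u * v = p)"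
proof -
  define B where "B = m * (2 * m\<^sup>2 + 1) + Suc m"
  have "enat B < F (Suc m)" using assms by simp
  then obtain A where A: "finite A" "card A = Suc m"
    and big: "enat B < ecard {x. (\<lambda>a. a + x) ` A \<subseteq> SQ}"
    unfolding F_def less_SUP_iff by auto
  obtain Y where Y: "finite Y" "card Y = B" "Y \<subseteq> {x. (\<lambda>a. a + x) ` A \<subseteq> SQ}"
  proof (cases "finite {x. (\<lambda>a. a + x) ` A \<subseteq> SQ}")
    case True
    then have "B \<le> card {x. (\<lambda>a. a + x) ` A \<subseteq> SQ}" using big by (simp add: ecard_def)
    then show ?thesis using that True by (meson obtain_subset_with_card_n)
  next
    case False
    then show ?thesis using that by (meson infinite_arbitrarily_large)
  qed
  have sq: "\<exists>z\<ge>0. z\<^sup>2 = a + x" if "x \<in> Y" "a \<in> A" for a x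
  proof -
    have "a + x \<in> SQ" using Y that by auto
    then obtain z where "a + x = z\<^sup>2" by (auto simp: SQ_def)
    then show ?thesis by (intro exI[of _ "\<bar>z\<bar>"]) auto
  qed
  then obtain z where z: "\<And>x a. x \<in> Y \<Longrightarrow> a \<in> A \<Longrightarrow> z x a \<ge> 0 \<and> (z x a)\<^sup>2 = a + x" by metis
  obtain b where b: "b \<in> A" using A by fastforce
  \<comment> \<open>translates carrying an element of \<open>A\<close> to \<open>0\<close> are dropped: there the two roots would coincide\<close>
  define Y' where "Y' = Y - uminus ` A"
  have cY': "m * (2 * m\<^sup>2 + 1) \<le> card Y'"
  proof -
    have "card Y - card (uminus ` A) \<le> card Y'"
      unfolding Y'_def using A by (intro diff_card_le_card_Diff) auto
    moreover have "card (uminus ` A) \<le> Suc m" using A card_image_le by metis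
    ultimately show ?thesis using Y by (simp add: B_def)
  qed
  let ?P = "(\<lambda>a. b - a) ` (A - {b})" and ?X = "(\<lambda>x. 2 * z x b) ` Y'"
  have "inj_on (\<lambda>x. 2 * z x b) Y'"
  proof (rule inj_onI)
    fix x y assume "x \<in> Y'" "y \<in> Y'" and eq: "2 * z x b = 2 * z y b"
    then have "x \<in> Y" "y \<in> Y" by (auto simp: Y'_def)
    then have "(z x b)\<^sup>2 = b + x" "(z y b)\<^sup>2 = b + y" using z b by blast+
    moreover have "(z x b)\<^sup>2 = (z y b)\<^sup>2" using eq by simp
    ultimately show "x = y" by linarith
  qed
  then have cX: "card ?X = card Y'" by (rule card_image)
  show ?thesis
  proof (rule exI[where x = ?X], rule exI[where x = ?P], intro conjI ballI)
    show "finite ?P" "0 \<notin> ?P" "finite ?X" using A Y by (auto simp: Y'_def)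
    show "card ?P = m" using A b by (subst card_image) (auto simp: inj_on_def)
    show "m * (2 * m\<^sup>2 + 1) \<le> card ?X" using cX cY' by simp
    fix s p assume "s \<in> ?X" "p \<in> ?P"
    then obtain x a where x: "x \<in> Y" "x \<notin> uminus ` A" "s = 2 * z x b"
      and a: "a \<in> A" "p = b - a" by (auto simp: Y'_def)
    have "x \<noteq> - a" using x a by auto
    then have "z x a \<noteq> 0" using z[OF x(1) a(1)] by auto
    moreover have "(z x b + z x a) * (z x b - z x a) = p"
      using z[OF x(1) a(1)] z[OF x(1) b] a(2)
      by (simp add: power2_eq_square algebra_simps)
    ultimately show "\<exists>u v. u \<noteq> v \<and> u + v = s \<and> u * v = p"
      using x(3) by (intro exI[of _ "z x b + z x a"] exI[of _ "z x b - z x a"]) auto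
  qed
qed

section \<open>A Kovari--Sos--Turan bound\<close>

text \<open>Double counting of the pairs \<open>(s, B)\<close> with \<open>B\<close> a \<open>k\<close>-element set of neighbours of \<open>s\<close>.\<close>

lemma sum_choose_degrees_le:
  assumes "finite S" "finite P"
    and few: "\<And>B. B \<subseteq> P \<Longrightarrow> card B = k \<Longrightarrow> card {s \<in> S. \<forall>p\<in>B. (s, p) \<in> E} \<le> f"
  shows "(\<Sum>s\<in>S. card {p \<in> P. (s, p) \<in> E} choose k) \<le> f * (card P choose k)"
proof -
  let ?K = "{B. B \<subseteq> P \<and> card B = k}"
  have fK: "finite ?K" using assms(2) by simp
  have "card {p \<in> P. (s, p) \<in> E} choose k = card {B \<in> ?K. \<forall>p\<in>B. (s, p) \<in> E}" for s
  proof -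
    have "{B \<in> ?K. \<forall>p\<in>B. (s, p) \<in> E} = {B. B \<subseteq> {p \<in> P. (s, p) \<in> E} \<and> card B = k}" by auto
    moreover have "finite {p \<in> P. (s, p) \<in> E}" using assms(2) by simp
    ultimately show ?thesis using n_subsets[of "{p \<in> P. (s, p) \<in> E}" k] by metis
  qed
  then have "(\<Sum>s\<in>S. card {p \<in> P. (s, p) \<in> E} choose k)
      = (\<Sum>s\<in>S. card {B \<in> ?K. \<forall>p\<in>B. (s, p) \<in> E})" by simp
  also have "\<dots> = (\<Sum>s\<in>S. \<Sum>B\<in>?K. if \<forall>p\<in>B. (s, p) \<in> E then 1 else 0)"
    using fK by (intro sum.cong refl) (simp only: card_eq_sum sum.inter_filter)
  also have "\<dots> = (\<Sum>B\<in>?K. \<Sum>s\<in>S. if \<forall>p\<in>B. (s, p) \<in> E then 1 else 0)"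
    by (rule sum.swap)
  also have "\<dots> = (\<Sum>B\<in>?K. card {s \<in> S. \<forall>p\<in>B. (s, p) \<in> E})"
    using assms(1) by (intro sum.cong refl) (simp only: card_eq_sum sum.inter_filter)
  also have "\<dots> \<le> (\<Sum>B\<in>?K. f)" using few by (intro sum_mono) auto
  also have "\<dots> = f * (card P choose k)" using n_subsets[OF assms(2)] by simp
  finally show ?thesis .
qed

text \<open>Vertices of degree below half of \<open>n / N\<close> account for at most half of the \<open>n\<close> edges; they are
  discarded, after which the degree threshold \<open>t = n / (2 N)\<close> takes the place of the
  power mean inequality. The degrees that remain are at least \<open>k\<close> unless \<open>n < 2 k N\<close>, in which
  case the claim is immediate.\<close>

lemma kovari_sos_turan:
  assumes fin: "finite S" "finite P" and E: "E \<subseteq> S \<times> P"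
    and N: "card S \<le> N" "card P \<le> N" and k: "k \<ge> 1" and f: "f \<ge> 1"
    and few: "\<And>B. B \<subseteq> P \<Longrightarrow> card B = k \<Longrightarrow> card {s \<in> S. \<forall>p\<in>B. (s, p) \<in> E} \<le> 2 * f"
  shows "real (card E) ^ k \<le> real f * (4 * real k * real N) ^ (2 * k - 1)"
proof -
  define n where "n = real (card E)"
  define d where "d s = card {p \<in> P. (s, p) \<in> E}" for s
  have sum_d: "n = (\<Sum>s\<in>S. real (d s))"
  proof -
    have "E = Sigma S (\<lambda>s. {p \<in> P. (s, p) \<in> E})" using E by auto
    also have "card \<dots> = (\<Sum>s\<in>S. d s)"
      unfolding d_def using fin by (intro card_SigmaI) auto
    finally have "card E = (\<Sum>s\<in>S. d s)" .
    then show ?thesis by (simp add: n_def)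
  qed
  show ?thesis
  proof (cases "n = 0 \<or> n < 2 * real k * real N")
    case True
    have le: "n \<le> 4 * real k * real N" using True by (auto intro: order_trans[of n "2 * real k * real N"])
    have "n ^ k \<le> (4 * real k * real N) ^ (2 * k - 1)"
    proof (cases "card E = 0")
      case True
      then show ?thesis using k by (simp add: n_def power_0_left)
    next
      case False
      then have "1 \<le> n" by (simp add: n_def)
      then have "n ^ k \<le> n ^ (2 * k - 1)" using k by (intro power_increasing) auto
      also have "\<dots> \<le> (4 * real k * real N) ^ (2 * k - 1)"
        using le by (intro power_mono) (auto simp: n_def)
      finally show ?thesis .
    qed
    also have "\<dots> \<le> real f * (4 * real k * real N) ^ (2 * k - 1)"
      using f mult_right_mono[of 1 "real f" "(4 * real k * real N) ^ (2 * k - 1)"] by simp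
    finally show ?thesis by (simp add: n_def)
  next
    case False
    then have n0: "n > 0" and large: "2 * real k * real N \<le> n" by (auto simp: n_def)
    have "S \<noteq> {}" using n0 sum_d by auto
    then have N0: "real N > 0" using N(1) fin by (metis card_gt_0_iff of_nat_0_less_iff order_less_le_trans)
    define t where "t = n / (2 * real N)"
    have t: "real k \<le> t" using large N0 by (simp add: t_def field_simps)
    have t0: "t > 0" using t k by linarith
    define H where "H = {s \<in> S. t \<le> real (d s)}"
    have "n / 2 \<le> (\<Sum>s\<in>H. real (d s))"
    proof -
      have "n = (\<Sum>s\<in>H. real (d s)) + (\<Sum>s\<in>S - H. real (d s))"
        using sum_d sum.subset_diff[of H S "\<lambda>s. real (d s)"] fin by (simp add: H_def add.commute)
      moreover have "(\<Sum>s\<in>S - H. real (d s)) \<le> (\<Sum>s\<in>S - H. t)"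
        by (intro sum_mono) (auto simp: H_def)
      moreover have "(\<Sum>s\<in>S - H. t) \<le> real N * t"
      proof -
        have "card (S - H) \<le> N" using N(1) fin by (meson card_mono Diff_subset le_trans)
        then show ?thesis using t0 by simp
      qed
      moreover have "real N * t = n / 2" using N0 by (simp add: t_def)
      ultimately show ?thesis by linarith
    qed
    then have "n / 2 * (t / real k) ^ (k - 1) / real k
        \<le> (\<Sum>s\<in>H. real (d s)) * (t / real k) ^ (k - 1) / real k"
      using t0 by (intro divide_right_mono mult_right_mono) auto
    also have "\<dots> = (\<Sum>s\<in>H. (t / real k) ^ (k - 1) * (real (d s) / real k))"
      by (simp add: sum_distrib_left sum_distrib_right sum_divide_distrib mult.commute)
    also have "\<dots> \<le> (\<Sum>s\<in>H. real (d s choose k))"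
    proof (rule sum_mono)
      fix s assume "s \<in> H"
      then have s: "t \<le> real (d s)" by (simp add: H_def)
      then have "k \<le> d s" using t by linarith
      \<comment> \<open>one factor of the degree is kept, so that the sum over the remaining vertices counts edges\<close>
      have "(t / real k) ^ (k - 1) * (real (d s) / real k)
          \<le> (real (d s) / real k) ^ (k - 1) * (real (d s) / real k)"
        using s t0 by (intro mult_right_mono power_mono divide_right_mono) auto
      also have "\<dots> = (real (d s) / real k) ^ k"
        using k by (metis power_minus_mult less_le_trans zero_less_one)
      also have "\<dots> \<le> real (d s choose k)"
        using binomial_ge_n_over_k_pow_k[OF \<open>k \<le> d s\<close>, where 'a = real] by simp
      finally show "(t / real k) ^ (k - 1) * (real (d s) / real k) \<le> real (d s choose k)" .
    qed
    also have "\<dots> \<le> (\<Sum>s\<in>S. real (d s choose k))"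
      using fin by (intro sum_mono2) (auto simp: H_def)
    also have "\<dots> \<le> real (2 * f * (card P choose k))"
    proof -
      have "(\<Sum>s\<in>S. d s choose k) \<le> 2 * f * (card P choose k)"
        using sum_choose_degrees_le[OF fin few] unfolding d_def .
      then have "real (\<Sum>s\<in>S. d s choose k) \<le> real (2 * f * (card P choose k))"
        by (simp only: of_nat_le_iff)
      then show ?thesis by simp
    qed
    also have "\<dots> \<le> 2 * real f * real N ^ k"
    proof -
      have "card P choose k \<le> N ^ k"
      proof (cases "k \<le> card P")
        case True
        then have "card P choose k \<le> card P ^ k" by (rule binomial_le_pow)
        also have "\<dots> \<le> N ^ k" using N(2) by (intro power_mono) auto
        finally show ?thesis .
      qed (simp add: binomial_eq_0)
      then have "real (card P choose k) \<le> real N ^ k" by (metis of_nat_le_iff of_nat_power)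
      then show ?thesis by (simp add: mult_left_mono)
    qed
    finally have main: "n / 2 * (t / real k) ^ (k - 1) / real k \<le> 2 * real f * real N ^ k" .
    obtain j where j: "k = Suc j" using k by (cases k) auto
    have "n ^ k = (n / 2 * (t / real k) ^ j / real k) * (2 * real k) ^ k * real N ^ j"
    proof -
      have cancel: "n = n / 2 / real k * (2 * real k)" "n = t / real k * (2 * real k) * real N"
        using N0 k by (simp_all add: t_def)
      have pk: "(2 * real k) ^ k = (2 * real k) * (2 * real k) ^ j"
        using j by (metis power_Suc)
      have regroup: "(x / y * z) * (b * c * d) = (x * b / y) * (z * c) * d" for x y z b c d :: real
        by simp
      have "n ^ k = n * n ^ j" by (simp add: j)
      also have "\<dots> = (n / 2 / real k * (2 * real k)) * (t / real k * (2 * real k) * real N) ^ j"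
        using cancel by (metis (no_types))
      also have "\<dots> = (n / 2 / real k * (2 * real k)) *
          ((t / real k) ^ j * (2 * real k) ^ j * real N ^ j)"
        by (simp only: power_mult_distrib)
      also have "\<dots> = (n / 2 * (t / real k) ^ j / real k) * (2 * real k) ^ k * real N ^ j"
        unfolding pk by (rule regroup)
      finally show ?thesis .
    qed
    also have "\<dots> \<le> (2 * real f * real N ^ k) * (2 * real k) ^ k * real N ^ j"
      using main j by (intro mult_right_mono) auto
    also have "\<dots> = real f * (2 * (2 * real k) ^ k) * real N ^ (2 * k - 1)"
    proof -
      have "2 * k - 1 = k + j" using j by simp
      then have pN: "real N ^ (2 * k - 1) = real N ^ k * real N ^ j" by (metis power_add)
      have regroup: "(2 * x * y) * z * w = x * (2 * z) * (y * w)" for x y z w :: real by simp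
      show ?thesis unfolding pN by (rule regroup)
    qed
    also have "\<dots> \<le> real f * (4 * real k) ^ (2 * k - 1) * real N ^ (2 * k - 1)"
    proof (intro mult_right_mono mult_left_mono)
      have "2 * (2 * real k) ^ k \<le> 2 ^ k * (2 * real k) ^ k"
        using k self_le_power[of "2 :: real" k] by (intro mult_right_mono) auto
      also have "\<dots> = (4 * real k) ^ k" unfolding power_mult_distrib[symmetric] by simp
      also have "\<dots> \<le> (4 * real k) ^ (2 * k - 1)" using k by (intro power_increasing) auto
      finally show "2 * (2 * real k) ^ k \<le> (4 * real k) ^ (2 * k - 1)" .
    qed auto
    finally show ?thesis
      unfolding n_def power_mult_distrib[of "4 * real k" "real N"] by (simp only: mult.assoc)
  qed
qed

section \<open>Lower bounds over the integers\<close>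

text \<open>An integer is determined by its square and its sign.\<close>

lemma card_sq_preimage_le:
  fixes X :: "int set"
  assumes "finite X"
  shows "card {s \<in> S. s\<^sup>2 \<in> X} \<le> 2 * card X"
proof -
  have "card {s \<in> S. s\<^sup>2 \<in> X} \<le> card (X \<times> (UNIV :: bool set))"
  proof (rule card_inj_on_le[where f = "\<lambda>s. (s\<^sup>2, 0 \<le> s)"])
    show "inj_on (\<lambda>s. (s\<^sup>2, 0 \<le> s)) {s \<in> S. s\<^sup>2 \<in> X}"
      by (auto simp: inj_on_def power2_eq_iff)
  qed (use assms in auto)
  then show ?thesis by (simp add: card_cartesian_product)
qed

text \<open>The bound \<open>f\<close> is only required for translates by squares of sums, and for sets of values
  \<open>- 4 p\<close> with \<open>p\<close> a product. This covers both the bound from \<open>F\<close> and the one from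
  \<open>F_upto\<close>, where sets and translates are restricted to an interval.\<close>

lemma sp_max_int_lower_bound:
  fixes a :: "'v \<Rightarrow> int"
  assumes G: "matching_of_size n G" and inj: "inj_on a (verts G)"
    and k: "k \<ge> 1" and f: "f \<ge> 1"
    and few: "\<And>A. A \<subseteq> (\<lambda>p. - 4 * p) ` prodset_along G a \<Longrightarrow> card A = k \<Longrightarrow>
      finite {x \<in> power2 ` sumset_along G a. (\<lambda>b. b + x) ` A \<subseteq> SQ} \<and>
      card {x \<in> power2 ` sumset_along G a. (\<lambda>b. b + x) ` A \<subseteq> SQ} \<le> f"
  shows "real n powr (real k / (2 * real k - 1)) * real f powr (- 1 / (2 * real k - 1))
    \<le> 4 * real k * real (sp_max G a)"
proof -
  have simple: "simple_graph G" and disj: "disjoint (edges G)" and cE: "card (edges G) = n"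
    using G by (auto simp: matching_of_size_def)
  define S where "S = sumset_along G a"
  define P where "P = prodset_along G a"
  define E where "E = (\<lambda>e. (sum a e, prod a e)) ` edges G"
  have fin: "finite S" "finite P"
    using finite_edges[OF simple]
    by (auto simp: S_def P_def sumset_along_eq_image[OF simple] prodset_along_eq_image[OF simple])
  have E: "E \<subseteq> S \<times> P"
    by (auto simp: E_def S_def P_def sumset_along_eq_image[OF simple] prodset_along_eq_image[OF simple])
  have cardE: "card E = n"
    unfolding E_def using inj_on_sum_prod_edges[OF simple disj inj] cE by (simp add: card_image)
  have disc: "- 4 * p + s\<^sup>2 \<in> SQ" if sp: "(s, p) \<in> E" for s p
  proof -
    obtain e where e: "e \<in> edges G" "s = sum a e" "p = prod a e" using sp by (auto simp: E_def)
    then obtain u v where "e = {u, v}" "u \<noteq> v"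
      using simple by (auto simp: simple_graph_def card_2_iff)
    then have "- 4 * p + s\<^sup>2 = (a u - a v)\<^sup>2"
      using e by (simp add: power2_eq_square algebra_simps)
    then show ?thesis by (auto simp: SQ_def)
  qed
  have "card {s \<in> S. \<forall>p\<in>B. (s, p) \<in> E} \<le> 2 * f" if B: "B \<subseteq> P" "card B = k" for B
  proof -
    define A where "A = (\<lambda>p. - 4 * p) ` B"
    define X where "X = {x \<in> power2 ` S. (\<lambda>b. b + x) ` A \<subseteq> SQ}"
    have "card A = k" unfolding A_def using B by (subst card_image) (auto simp: inj_on_def)
    then have X: "finite X" "card X \<le> f"
      using few[of A] B by (auto simp: A_def X_def S_def P_def)
    have "card {s \<in> S. \<forall>p\<in>B. (s, p) \<in> E} \<le> card {s \<in> S. s\<^sup>2 \<in> X}"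
      using fin disc by (intro card_mono) (auto simp: X_def A_def)
    also have "\<dots> \<le> 2 * f" using card_sq_preimage_le[OF X(1), of S] X(2) by linarith
    finally show ?thesis .
  qed
  then have "real (card E) ^ k \<le> real f * (4 * real k * real (sp_max G a)) ^ (2 * k - 1)"
    using k f by (intro kovari_sos_turan[OF fin E]) (auto simp: sp_max_def S_def P_def)
  then have pw: "real n ^ k / real f \<le> (4 * real k * real (sp_max G a)) ^ (2 * k - 1)"
    using f cardE by (simp add: field_simps)
  show ?thesis
  proof (cases "n = 0")
    case False
    define q where "q = 2 * k - 1"
    have q: "q > 0" "real q = 2 * real k - 1" using k by (auto simp: q_def of_nat_diff)
    have "real n powr (real k / q) * real f powr (- 1 / q) = (real n ^ k / real f) powr (1 / q)"
      using f False
      by (simp add: powr_divide powr_powr powr_minus_divide flip: powr_realpow)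
    also have "\<dots> \<le> ((4 * real k * real (sp_max G a)) ^ q) powr (1 / q)"
      using pw by (intro powr_mono2) (auto simp: q_def)
    also have "\<dots> = 4 * real k * real (sp_max G a)"
    proof -
      have "sp_max G a \<noteq> 0" using size_le_sp_max_square[OF G inj] False by (intro notI) simp
      then have "4 * real k * real (sp_max G a) > 0" using k by simp
      then show ?thesis using q(1) by (simp add: powr_powr flip: powr_realpow)
    qed
    finally show ?thesis using q(2) by simp
  qed auto
qed

lemma F_bound:
  assumes "F k \<le> enat f" "finite A" "card A = k"
  shows "finite {x. (\<lambda>b. b + x) ` A \<subseteq> SQ} \<and> card {x. (\<lambda>b. b + x) ` A \<subseteq> SQ} \<le> f"
proof -
  have "ecard {x. (\<lambda>b. b + x) ` A \<subseteq> SQ} \<le> F k"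
    unfolding F_def using assms by (intro SUP_upper) auto
  also note assms(1)
  finally show ?thesis by (auto simp: ecard_def split: if_splits)
qed

lemma F_upto_bound:
  assumes "A \<subseteq> {- int N..int N}" "card A = k"
  shows "card {x \<in> {- int N..int N}. (\<lambda>b. b + x) ` A \<subseteq> SQ} \<le> F_upto k N"
  unfolding F_upto_def using assms
  by (intro cSUP_upper) (auto intro!: bdd_above_finite finite_imageI)

lemma SP_int_bigomega:
  fixes M :: "nat \<Rightarrow> 'v graph"
  assumes M: "\<And>n. n \<ge> 1 \<Longrightarrow> matching_of_size n (M n)" and k: "k \<ge> 1" and fin: "F k < \<infinity>"
  shows "(\<lambda>n. real (SP TYPE(int) (M n))) \<in> \<Omega>(\<lambda>n. real n powr (real k / (2 * real k - 1)))"
proof -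
  obtain f0 where f0: "F k = enat f0" using fin by (cases "F k") auto
  \<comment> \<open>a positive bound is convenient: a negative power of it is taken\<close>
  define f where "f = max 1 f0"
  have f: "F k \<le> enat f" "f \<ge> 1" using f0 by (auto simp: f_def)
  define c where "c = real f powr (- 1 / (2 * real k - 1)) / (4 * real k)"
  have c: "c > 0" using f k by (simp add: c_def)
  have "c * real n powr (real k / (2 * real k - 1)) \<le> real (SP TYPE(int) (M n))" if n: "n \<ge> 1" for n
  proof -
    have G: "matching_of_size n (M n)" using M n by blast
    then have simple: "simple_graph (M n)" by (simp add: matching_of_size_def)
    then obtain a :: "'v \<Rightarrow> int" where a: "inj_on a (verts (M n))" "SP TYPE(int) (M n) = sp_max (M n) a"
      using SP_attained infinite_UNIV_int by metis
    have "real n powr (real k / (2 * real k - 1)) * real f powr (- 1 / (2 * real k - 1))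
        \<le> 4 * real k * real (sp_max (M n) a)"
    proof (rule sp_max_int_lower_bound[OF G a(1) k f(2)])
      fix A assume A: "A \<subseteq> (\<lambda>p. - 4 * p) ` prodset_along (M n) a" "card A = k"
      have "finite A" using A(2) k by (metis card.infinite not_one_le_zero)
      with F_bound[OF f(1) this A(2)]
      show "finite {x \<in> power2 ` sumset_along (M n) a. (\<lambda>b. b + x) ` A \<subseteq> SQ} \<and>
        card {x \<in> power2 ` sumset_along (M n) a. (\<lambda>b. b + x) ` A \<subseteq> SQ} \<le> f"
        by (auto intro: order_trans[OF card_mono])
    qed
    then show ?thesis using k a(2) by (simp add: c_def field_simps)
  qed
  then show ?thesis using c
    by (intro landau_omega.bigI[OF c] eventually_sequentiallyI[of 1]) auto
qed

text \<open>Values in \<open>[- t, t]\<close> make \<open>s\<^sup>2\<close> and \<open>- 4 p\<close> lie in \<open>[- 4 t\<^sup>2, 4 t\<^sup>2]\<close>. When \<open>F_upto\<close> is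
  \<open>0\<close>, the factor containing it is \<open>0 powr _ = 0\<close> and the claim is trivial.\<close>

lemma sp_max_bounded_int_lower_bound:
  fixes a :: "'v \<Rightarrow> int"
  assumes G: "matching_of_size n G" and k: "k \<ge> 1" and inj: "inj_on a (verts G)"
    and range: "a ` verts G \<subseteq> {- int t..int t}"
  shows "1 / (4 * real k) * (real n powr (real k / (2 * real k - 1)) *
      real (F_upto k (4 * t\<^sup>2)) powr (- 1 / (2 * real k - 1))) \<le> real (sp_max G a)"
proof (cases "F_upto k (4 * t\<^sup>2) = 0")
  case False
  define I where "I = {- int (4 * t\<^sup>2)..int (4 * t\<^sup>2)}"
  have abs: "\<bar>a w\<bar> \<le> int t" if "{u, v} \<in> edges G" "w \<in> {u, v}" for u v w
  proof -
    have "w \<in> verts G" using that G by (auto simp: matching_of_size_def)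
    then show ?thesis using range by fastforce
  qed
  have S: "power2 ` sumset_along G a \<subseteq> I"
  proof
    fix x assume "x \<in> power2 ` sumset_along G a"
    then obtain u v where uv: "{u, v} \<in> edges G" "x = (a u + a v)\<^sup>2"
      by (auto simp: sumset_along_def)
    have "\<bar>a u + a v\<bar> \<le> 2 * int t" using abs[OF uv(1), of u] abs[OF uv(1), of v] by simp
    then have "(a u + a v)\<^sup>2 \<le> (2 * int t)\<^sup>2" by (metis abs_le_square_iff abs_of_nonneg of_nat_0_le_iff mult_nonneg_nonneg zero_le_numeral)
    then show "x \<in> I" using uv(2) by (auto simp: I_def power_mult_distrib intro: order_trans[of _ 0])
  qed
  have P: "(\<lambda>p. - 4 * p) ` prodset_along G a \<subseteq> I"
  proof
    fix x assume "x \<in> (\<lambda>p. - 4 * p) ` prodset_along G a"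
    then obtain u v where uv: "{u, v} \<in> edges G" "x = - 4 * (a u * a v)"
      by (auto simp: prodset_along_def)
    have "\<bar>a u * a v\<bar> \<le> int t * int t"
      unfolding abs_mult using abs[OF uv(1), of u] abs[OF uv(1), of v] by (intro mult_mono) auto
    then show "x \<in> I" using uv(2) by (auto simp: I_def power2_eq_square abs_le_iff)
  qed
  have "real n powr (real k / (2 * real k - 1)) *
      real (F_upto k (4 * t\<^sup>2)) powr (- 1 / (2 * real k - 1)) \<le> 4 * real k * real (sp_max G a)"
  proof (rule sp_max_int_lower_bound[OF G inj k])
    show "F_upto k (4 * t\<^sup>2) \<ge> 1" using False by simp
    fix A assume A: "A \<subseteq> (\<lambda>p. - 4 * p) ` prodset_along G a" "card A = k"
    have "A \<subseteq> I" using A P by blast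
    with F_upto_bound[of A "4 * t\<^sup>2" k] A(2)
    have 1: "card {x \<in> I. (\<lambda>b. b + x) ` A \<subseteq> SQ} \<le> F_upto k (4 * t\<^sup>2)"
      by (simp add: I_def)
    have 2: "{x \<in> power2 ` sumset_along G a. (\<lambda>b. b + x) ` A \<subseteq> SQ} \<subseteq> {x \<in> I. (\<lambda>b. b + x) ` A \<subseteq> SQ}"
      using S by auto
    have 3: "finite {x \<in> I. (\<lambda>b. b + x) ` A \<subseteq> SQ}"
      unfolding I_def by (rule finite_subset[OF _ finite_atLeastAtMost_int]) auto
    show "finite {x \<in> power2 ` sumset_along G a. (\<lambda>b. b + x) ` A \<subseteq> SQ} \<and>
        card {x \<in> power2 ` sumset_along G a. (\<lambda>b. b + x) ` A \<subseteq> SQ} \<le> F_upto k (4 * t\<^sup>2)"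
      using finite_subset[OF 2 3] card_mono[OF 3 2] 1 by simp
  qed
  then show ?thesis using k by (simp add: field_simps)
qed auto

theorem theorem2:
  fixes M :: "nat \<Rightarrow> 'v graph"
  assumes "\<And>n. n \<ge> 1 \<Longrightarrow> matching_of_size n (M n)"
  shows "(\<forall>n\<ge>1. int (SP TYPE(real) (M n)) = \<lceil>sqrt (real n)\<rceil>) \<and>
    ((\<forall>k\<ge>1. F k = \<infinity>) \<longrightarrow> (\<forall>n\<ge>1. int (SP TYPE(int) (M n)) = \<lceil>sqrt (real n)\<rceil>)) \<and>
    (\<forall>k\<ge>1. F k < \<infinity> \<longrightarrow>
       (\<lambda>n. real (SP TYPE(int) (M n))) \<in> \<Omega>(\<lambda>n. real n powr (real k / (2 * real k - 1)))) \<and>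
    (\<forall>k\<ge>1. \<exists>c>0::real. \<forall>\<^sub>F n in sequentially. \<forall>t::nat. \<forall>a :: 'v \<Rightarrow> int.
       inj_on a (verts (M n)) \<and> a ` verts (M n) \<subseteq> {- int t..int t} \<longrightarrow>
       real (sp_max (M n) a) \<ge>
         c * (real n powr (real k / (2 * real k - 1)) *
              real (F_upto k (4 * t\<^sup>2)) powr (- 1 / (2 * real k - 1))))"
proof (intro conjI allI impI)
  fix n :: nat assume n: "n \<ge> 1"
  show "int (SP TYPE(real) (M n)) = \<lceil>sqrt (real n)\<rceil>"
    by (rule SP_eq_ceiling_sqrt[OF assms[OF n] infinite_UNIV_char_0 real_sums_and_products])
next
  fix n :: nat assume F: "\<forall>k\<ge>1. F k = \<infinity>" and n: "n \<ge> 1"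
  show "int (SP TYPE(int) (M n)) = \<lceil>sqrt (real n)\<rceil>"
    using F by (intro SP_eq_ceiling_sqrt[OF assms[OF n] infinite_UNIV_int] int_sums_and_products) simp
next
  fix k :: nat assume k: "k \<ge> 1" and F: "F k < \<infinity>"
  show "(\<lambda>n. real (SP TYPE(int) (M n))) \<in> \<Omega>(\<lambda>n. real n powr (real k / (2 * real k - 1)))"
    by (rule SP_int_bigomega[OF assms k F])
next
  fix k :: nat assume k: "k \<ge> 1"
  show "\<exists>c>0::real. \<forall>\<^sub>F n in sequentially. \<forall>t::nat. \<forall>a :: 'v \<Rightarrow> int.
       inj_on a (verts (M n)) \<and> a ` verts (M n) \<subseteq> {- int t..int t} \<longrightarrow>
       real (sp_max (M n) a) \<ge>
         c * (real n powr (real k / (2 * real k - 1)) *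
              real (F_upto k (4 * t\<^sup>2)) powr (- 1 / (2 * real k - 1)))"
    using k sp_max_bounded_int_lower_bound[OF assms k]
    by (intro exI[of _ "1 / (4 * real k)"] conjI eventually_sequentiallyI[of 1]) auto
qed

end
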